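(* Let $P$ be a poset in which every principal order ideal is finite. Suppose $\delta,\lambda\in J(P)$ are such that $\delta\subseteq\lambda$ and every non-maximal element of $\delta$ is less than at least $2$ maximal elements of $\delta$. Then for every $\mu\in J(P)$ with $\mu\subseteq\delta\setminus\max(\delta)$, the lattice $J(\lambda\setminus\mu)$ is an Atniss win if and only if the lattice $J(\lambda)$ is an Atniss win.
   Context: $J(Q)$ denotes the lattice of finite order ideals of a poset $Q$, ordered by containment; subsets of $P$ (such as $\lambda\setminus\mu$) are viewed as induced subposets. $\max(Q)$ is the set of maximal elements of $Q$. Ungar game: for a finite lattice $L$ and $x\in L$, an Ungar move sends $x$ to $\bigwedge(\{x\}\cup T)$ with $T$ a subset of the elements covered by $x$; it is nontrivial if $T\ne\emptyset$. (In $J(Q)$ this means removing a subset of the maximal elements of an ideal.) Starting at the top element $\hat1$, Atniss (first) and Eeta alternately make nontrivial Ungar moves; the player who cannot move (i.e. faces $\hat0$) loses. $L$ is an Atniss win if Atniss has a winning strategy, otherwise an Eeta win. *)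

theory Defs
  imports "HOL-Algebra.Lattice"
begin

text \<open>Posets are represented by their carrier, as in HOL-Algebra; the subposet of \<open>P\<close> induced on
  \<open>A\<close> is \<open>P\<lparr>carrier := A\<rparr>\<close>.\<close>

definition ideal_lattice :: "('a, 'b) gorder_scheme \<Rightarrow> 'a set gorder"
  where "ideal_lattice Q =
    \<lparr>carrier = {I. I \<subseteq> carrier Q \<and> finite I \<and>
                    (\<forall>x\<in>I. \<forall>y\<in>carrier Q. y \<sqsubseteq>\<^bsub>Q\<^esub> x \<longrightarrow> y \<in> I)},
     eq = (=), le = (\<subseteq>)\<rparr>"

definition maximal_elements :: "('a, 'b) gorder_scheme \<Rightarrow> 'a set"
  where "maximal_elements Q = {x \<in> carrier Q. \<not> (\<exists>y\<in>carrier Q. x \<sqsubset>\<^bsub>Q\<^esub> y)}"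

definition lower_covers :: "('a, 'b) gorder_scheme \<Rightarrow> 'a \<Rightarrow> 'a set"
  where "lower_covers L x =
    {y \<in> carrier L. y \<sqsubset>\<^bsub>L\<^esub> x \<and> \<not> (\<exists>z\<in>carrier L. y \<sqsubset>\<^bsub>L\<^esub> z \<and> z \<sqsubset>\<^bsub>L\<^esub> x)}"

definition nontrivial_ungar_move :: "('a, 'b) gorder_scheme \<Rightarrow> 'a \<Rightarrow> 'a \<Rightarrow> bool"
  where "nontrivial_ungar_move L x y \<longleftrightarrow>
    (\<exists>T. T \<subseteq> lower_covers L x \<and> T \<noteq> {} \<and> y = \<Sqinter>\<^bsub>L\<^esub>({x} \<union> T))"

text \<open>A partial play of the Ungar game is the nonempty list of positions visited so far, in
  chronological order. Since Atniss moves first, it is her turn exactly when this list has odd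
  length.\<close>

definition ungar_play :: "('a, 'b) gorder_scheme \<Rightarrow> 'a list \<Rightarrow> bool"
  where "ungar_play L xs \<longleftrightarrow>
    xs \<noteq> [] \<and> hd xs = \<top>\<^bsub>L\<^esub> \<and> successively (nontrivial_ungar_move L) xs"

definition ungar_play_over :: "('a, 'b) gorder_scheme \<Rightarrow> 'a list \<Rightarrow> bool"
  where "ungar_play_over L xs \<longleftrightarrow>
    ungar_play L xs \<and> \<not> (\<exists>y. nontrivial_ungar_move L (last xs) y)"

definition atniss_strategy :: "('a, 'b) gorder_scheme \<Rightarrow> ('a list \<Rightarrow> 'a) \<Rightarrow> bool"
  where "atniss_strategy L \<sigma> \<longleftrightarrow>
    (\<forall>xs. ungar_play L xs \<and> odd (length xs) \<and> \<not> ungar_play_over L xs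
       \<longrightarrow> nontrivial_ungar_move L (last xs) (\<sigma> xs))"

definition atniss_follows :: "('a list \<Rightarrow> 'a) \<Rightarrow> 'a list \<Rightarrow> bool"
  where "atniss_follows \<sigma> xs \<longleftrightarrow>
    (\<forall>n. odd n \<and> n < length xs \<longrightarrow> xs ! n = \<sigma> (take n xs))"

text \<open>The definition below is meant for finite lattices, where every play is finite. A finished
  play of even length is one in which Eeta is unable to move.\<close>

definition atniss_win :: "('a, 'b) gorder_scheme \<Rightarrow> bool"
  where "atniss_win L \<longleftrightarrow>
    (\<exists>\<sigma>. atniss_strategy L \<sigma> \<and>
         (\<forall>xs. ungar_play_over L xs \<and> atniss_follows \<sigma> xs \<longrightarrow> even (length xs)))"

end

theory Submission
  imports Defs
begin

text \<open>In \<open>J(Q)\<close> a move deletes a nonempty set of maximal elements, so the game only depends on the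
  induced poset that is left. If deleting a maximal element \<open>m\<close> creates no new maximal elements,
  then the player to move wins: delete \<open>m\<close> if this leaves a losing position, and otherwise delete
  \<open>m\<close> together with the winning reply. As long as \<open>\<delta>\<close> is intact, the maximal elements of a
  position \<open>I\<close> do not change when \<open>\<mu>\<close> is removed from it. If one of them is maximal in \<open>\<delta>\<close>,
  then deleting it creates no new maximal elements, by the hypothesis on \<open>\<delta>\<close>, so both positions
  are wins; otherwise every move keeps \<open>\<delta>\<close> intact, and induction applies.\<close>

section \<open>Winning positions of a two-player game\<close>

text \<open>One rule covers two plies: a premise \<open>\<not> mover_wins R y\<close> would not be
  monotone, so it could not occur in an inductive definition.\<close>

inductive mover_wins :: "('a \<Rightarrow> 'a \<Rightarrow> bool) \<Rightarrow> 'a \<Rightarrow> bool" for R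
  where "R x y \<Longrightarrow> \<forall>z. R y z \<longrightarrow> mover_wins R z \<Longrightarrow> mover_wins R x"

text \<open>Termination turns the least fixed point into the usual recursion; with infinite plays, a
  position not won by the mover could be a draw instead of a loss.\<close>

lemma mover_wins_iff:
  assumes "termip R x"
  shows "mover_wins R x \<longleftrightarrow> (\<exists>y. R x y \<and> \<not> mover_wins R y)"
  using assms
proof (induction rule: accp_induct_rule)
  case (1 x)
  then have "\<not> mover_wins R y \<longleftrightarrow> (\<forall>z. R y z \<longrightarrow> mover_wins R z)" if "R x y" for y
    using that by auto
  then show ?case
    by (subst mover_wins.simps) blast
qed

text \<open>The two relations need to agree only on a set \<open>A\<close> closed under moves. Later
  \<open>A\<close> consists of the order ideals, where Ungar moves are shown to be removals.\<close>

lemma mover_wins_mono_on: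
  assumes "mover_wins R x" and "x \<in> A"
    and "\<And>x y. x \<in> A \<Longrightarrow> R x y \<longleftrightarrow> R' x y"
    and "\<And>x y. x \<in> A \<Longrightarrow> R x y \<Longrightarrow> y \<in> A"
  shows "mover_wins R' x"
  using assms(1,2)
proof (induction rule: mover_wins.induct)
  case (1 x y)
  with assms(3,4) show ?case
    by (intro mover_wins.intros[of R' x y]) blast+
qed

lemma mover_wins_cong_on:
  assumes "x \<in> A"
    and "\<And>x y. x \<in> A \<Longrightarrow> R x y \<longleftrightarrow> R' x y"
    and "\<And>x y. x \<in> A \<Longrightarrow> R x y \<Longrightarrow> y \<in> A"
  shows "mover_wins R x \<longleftrightarrow> mover_wins R' x"
  using mover_wins_mono_on[of R x A R'] mover_wins_mono_on[of R' x A R] assms by blast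

section \<open>Plays, strategies and winning positions\<close>

lemma ungar_play_snoc:
  assumes "xs \<noteq> []"
  shows "ungar_play L (xs @ [y]) \<longleftrightarrow> ungar_play L xs \<and> nontrivial_ungar_move L (last xs) y"
  using assms by (auto simp: ungar_play_def successively_append_iff)

lemma atniss_follows_snoc:
  "atniss_follows \<sigma> (xs @ [y]) \<longleftrightarrow> atniss_follows \<sigma> xs \<and> (odd (length xs) \<longrightarrow> y = \<sigma> xs)"
  by (auto simp: atniss_follows_def nth_append less_Suc_eq)

lemma atniss_win_if_mover_wins:
  assumes "mover_wins (nontrivial_ungar_move L) \<top>\<^bsub>L\<^esub>"
  shows "atniss_win L"
proof -
  let ?R = "nontrivial_ungar_move L"
  let ?good = "\<lambda>x y. ?R x y \<and> (\<forall>z. ?R y z \<longrightarrow> mover_wins ?R z)"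
  \<comment> \<open>A strategy must name a legal move in every unfinished play on Atniss's turn,
    even from a position that is not won; hence the arbitrary move in the second branch.\<close>
  define \<sigma> where "\<sigma> xs = (if mover_wins ?R (last xs) then SOME y. ?good (last xs) y
    else SOME y. ?R (last xs) y)" for xs
  have good: "?good (last xs) (\<sigma> xs)" if "mover_wins ?R (last xs)" for xs
  proof -
    have "\<exists>y. ?good (last xs) y"
      using that by (auto elim: mover_wins.cases)
    then have "?good (last xs) (SOME y. ?good (last xs) y)"
      by (rule someI_ex)
    with that show ?thesis
      by (simp add: \<sigma>_def)
  qed
  have "atniss_strategy L \<sigma>"
    unfolding atniss_strategy_def
  proof (intro allI impI)
    fix xs
    assume xs: "ungar_play L xs \<and> odd (length xs) \<and> \<not> ungar_play_over L xs"
    show "?R (last xs) (\<sigma> xs)"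
    proof (cases "mover_wins ?R (last xs)")
      case True
      then show ?thesis
        using good by blast
    next
      case False
      from xs have "\<exists>y. ?R (last xs) y"
        by (simp add: ungar_play_over_def)
      with False show ?thesis
        by (simp add: \<sigma>_def someI_ex)
    qed
  qed
  \<comment> \<open>Invariant of plays that follow \<sigma>: Atniss always faces a won position, and
    Eeta can only move to won ones. A won position has a move, so no such play ends on Atniss's
    turn.\<close>
  moreover have "if odd (length xs) then mover_wins ?R (last xs)
      else (\<forall>z. ?R (last xs) z \<longrightarrow> mover_wins ?R z)"
    if "ungar_play L xs" "atniss_follows \<sigma> xs" for xs
    using that
  proof (induction xs rule: rev_induct)
    case Nil
    then show ?case
      by (simp add: ungar_play_def)
  next
    case (snoc y xs)
    show ?case
    proof (cases "xs = []")
      case True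
      with snoc.prems assms show ?thesis
        by (simp add: ungar_play_def)
    next
      case False
      with snoc good[of xs] show ?thesis
        by (auto simp: ungar_play_snoc atniss_follows_snoc split: if_splits)
    qed
  qed
  then have "even (length xs)" if "ungar_play_over L xs" "atniss_follows \<sigma> xs" for xs
    using that by (metis mover_wins.cases ungar_play_over_def)
  ultimately show ?thesis
    unfolding atniss_win_def by blast
qed

lemma mover_wins_if_atniss_win:
  assumes "termip (nontrivial_ungar_move L) \<top>\<^bsub>L\<^esub>" and "atniss_win L"
  shows "mover_wins (nontrivial_ungar_move L) \<top>\<^bsub>L\<^esub>"
proof (rule ccontr)
  let ?R = "nontrivial_ungar_move L"
  assume lose: "\<not> mover_wins ?R \<top>\<^bsub>L\<^esub>"
  from assms(2) obtain \<sigma> where \<sigma>: "atniss_strategy L \<sigma>"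
    and win: "\<And>xs. ungar_play_over L xs \<Longrightarrow> atniss_follows \<sigma> xs \<Longrightarrow> even (length xs)"
    unfolding atniss_win_def by blast
  \<comment> \<open>No play following \<sigma> reaches a position bad for Atniss: lost on her own
    turn, or one from which Eeta can move to a lost position. The induction settles all successors
    of a position first. The one-element play then contradicts \<open>lose\<close>.\<close>
  have "\<not> (if odd (length xs) then \<not> mover_wins ?R x
      else \<exists>z. ?R x z \<and> \<not> mover_wins ?R z)"
    if "termip ?R x" "ungar_play L xs" "atniss_follows \<sigma> xs" "last xs = x" for x xs
    using that
  proof (induction arbitrary: xs rule: accp_induct_rule)
    case (1 x)
    have ne: "xs \<noteq> []"
      using 1 by (auto simp: ungar_play_def)
    \<comment> \<open>Appending \<open>y\<close> flips the parity of the length, hence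
      \<open>even\<close> where the claim has \<open>odd\<close>.\<close>
    have IH: "\<not> (if even (length xs) then \<not> mover_wins ?R y
        else \<exists>z. ?R y z \<and> \<not> mover_wins ?R z)"
      if "?R x y" "odd (length xs) \<Longrightarrow> y = \<sigma> xs" for y
      using 1(2)[of y "xs @ [y]"] that 1(3-) ne by (simp add: ungar_play_snoc atniss_follows_snoc)
    show ?case
    proof (cases "odd (length xs)")
      case True
      \<comment> \<open>A play ending here would have odd length, against \<open>win\<close>; so the
        play is unfinished and \<sigma> supplies a legal move.\<close>
      then have "?R x (\<sigma> xs)"
        using \<sigma> 1(3-) win[of xs] unfolding atniss_strategy_def by blast
      then show ?thesis
        using IH[of "\<sigma> xs"] True mover_wins.intros[of ?R x "\<sigma> xs"] by auto
    next
      case False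
      then show ?thesis
        using IH by auto
    qed
  qed
  from this[OF assms(1), of "[\<top>\<^bsub>L\<^esub>]"] lose show False
    by (simp add: ungar_play_def atniss_follows_def)
qed

section \<open>The game of removing maximal elements\<close>

lemma mem_maximal_elements_restrict:
  "x \<in> maximal_elements (P\<lparr>carrier := I\<rparr>) \<longleftrightarrow> x \<in> I \<and> (\<forall>y\<in>I. \<not> x \<sqsubset>\<^bsub>P\<^esub> y)"
  by (auto simp: maximal_elements_def lless_def)

text \<open>Defined for arbitrary sets, since positions of the game on
  \<open>\<Lambda> - \<mu>\<close> need not be ideals of \<open>P\<close> and both games are to
  share one relation.\<close>

definition removal_move :: "('a, 'b) gorder_scheme \<Rightarrow> 'a set \<Rightarrow> 'a set \<Rightarrow> bool"
  where "removal_move P I J \<longleftrightarrow>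
    (\<exists>S. S \<subseteq> maximal_elements (P\<lparr>carrier := I\<rparr>) \<and> S \<noteq> {} \<and> J = I - S)"

lemma removal_move_psubset:
  assumes "removal_move P I J"
  shows "J \<subset> I"
proof -
  from assms obtain S where "S \<subseteq> maximal_elements (P\<lparr>carrier := I\<rparr>)" "S \<noteq> {}" "J = I - S"
    by (auto simp: removal_move_def)
  then show ?thesis
    by (auto simp: mem_maximal_elements_restrict subset_iff)
qed

lemma termip_removal_move:
  assumes "finite I"
  shows "termip (removal_move P) I"
  using assms
proof (induction rule: finite_psubset_induct)
  case (psubset I)
  show ?case
    by (rule accp.accI) (metis conversep_iff psubset.IH removal_move_psubset)
qed

lemma mover_wins_removal_move_iff:
  assumes "finite I"
  shows "mover_wins (removal_move P) I \<longleftrightarrow>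
    (\<exists>S \<subseteq> maximal_elements (P\<lparr>carrier := I\<rparr>). S \<noteq> {} \<and> \<not> mover_wins (removal_move P) (I - S))"
  by (subst mover_wins_iff[OF termip_removal_move[OF assms]]) (auto simp: removal_move_def)

lemma mover_wins_if_redundant_maximal:
  assumes "finite I" and m: "m \<in> maximal_elements (P\<lparr>carrier := I\<rparr>)"
    and sub: "maximal_elements (P\<lparr>carrier := I - {m}\<rparr>) \<subseteq> maximal_elements (P\<lparr>carrier := I\<rparr>)"
  shows "mover_wins (removal_move P) I"
proof (cases "mover_wins (removal_move P) (I - {m})")
  case True
  \<comment> \<open>\<open>S\<close> is a winning reply to the removal of \<open>m\<close>. By
    \<open>sub\<close> its elements are already maximal in \<open>I\<close>, so a single move can
    remove \<open>m\<close> and \<open>S\<close> together.\<close>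
  then obtain S where "S \<subseteq> maximal_elements (P\<lparr>carrier := I - {m}\<rparr>)"
    and lose: "\<not> mover_wins (removal_move P) (I - {m} - S)"
    using assms(1) by (subst (asm) mover_wins_removal_move_iff) auto
  with m sub have "insert m S \<subseteq> maximal_elements (P\<lparr>carrier := I\<rparr>)"
    by blast
  moreover have "I - insert m S = I - {m} - S"
    by blast
  ultimately show ?thesis
    using lose by (subst mover_wins_removal_move_iff[OF assms(1)]) (metis insert_not_empty)
next
  case False
  with m show ?thesis
    by (subst mover_wins_removal_move_iff[OF assms(1)]) blast
qed

section \<open>Covers, meets and moves in the lattice of order ideals\<close>

lemma ideal_lattice_carrier_iff:
  "I \<in> carrier (ideal_lattice Q) \<longleftrightarrow>
    I \<subseteq> carrier Q \<and> finite I \<and> (\<forall>x\<in>I. \<forall>y\<in>carrier Q. y \<sqsubseteq>\<^bsub>Q\<^esub> x \<longrightarrow> y \<in> I)"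
  by (simp add: ideal_lattice_def)

lemma ideal_lattice_le [simp]: "I \<sqsubseteq>\<^bsub>ideal_lattice Q\<^esub> J \<longleftrightarrow> I \<subseteq> J"
  by (simp add: ideal_lattice_def)

lemma ideal_lattice_less [simp]: "I \<sqsubset>\<^bsub>ideal_lattice Q\<^esub> J \<longleftrightarrow> I \<subset> J"
  by (auto simp: ideal_lattice_def lless_def)

text \<open>Top and infimum are defined by choice, so computing them takes uniqueness besides a
  witness.\<close>

lemma greatest_ideal_lattice_unique:
  assumes "greatest (ideal_lattice Q) I A" and "greatest (ideal_lattice Q) J A"
  shows "I = J"
  using assms by (auto simp: greatest_def)

lemma ideal_lattice_top:
  assumes "finite (carrier Q)"
  shows "\<top>\<^bsub>ideal_lattice Q\<^esub> = carrier Q"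
proof -
  have "greatest (ideal_lattice Q) (carrier Q) (carrier (ideal_lattice Q))"
    using assms by (auto simp: greatest_def ideal_lattice_carrier_iff)
  then show ?thesis
    unfolding top_def by (rule some_equality) (rule greatest_ideal_lattice_unique[OF _ \<open>greatest _ _ _\<close>])
qed

lemma ideal_diff_maximal:
  assumes "partial_order Q" and I: "I \<in> carrier (ideal_lattice Q)"
    and S: "S \<subseteq> maximal_elements (Q\<lparr>carrier := I\<rparr>)"
  shows "I - S \<in> carrier (ideal_lattice Q)"
proof -
  interpret partial_order Q by fact
  have "y \<notin> S" if "x \<in> I - S" "y \<sqsubseteq>\<^bsub>Q\<^esub> x" for x y
  proof
    assume "y \<in> S"
    with that S have "\<not> y \<sqsubset>\<^bsub>Q\<^esub> x"
      by (auto simp: mem_maximal_elements_restrict)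
    with that \<open>y \<in> S\<close> show False
      by (auto simp: lless_def eq_is_equal)
  qed
  with I show ?thesis
    by (auto simp: ideal_lattice_carrier_iff)
qed

lemma exists_maximal_element:
  assumes "partial_order Q" and "finite A" and "A \<noteq> {}" and "A \<subseteq> carrier Q"
  shows "\<exists>m. m \<in> maximal_elements (Q\<lparr>carrier := A\<rparr>)"
proof -
  interpret partial_order Q by fact
  have "asymp_on A (\<sqsubset>\<^bsub>Q\<^esub>)"
    using assms(4) le_antisym by (intro asymp_onI) (auto simp: lless_def eq_is_equal)
  moreover have "transp_on A (\<sqsubset>\<^bsub>Q\<^esub>)"
  proof (rule transp_onI)
    fix x y z
    assume "x \<in> A" "y \<in> A" "z \<in> A" "x \<sqsubset>\<^bsub>Q\<^esub> y" "y \<sqsubset>\<^bsub>Q\<^esub> z"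
    moreover from this assms(4) have "x \<in> carrier Q" "y \<in> carrier Q" "z \<in> carrier Q"
      by auto
    ultimately show "x \<sqsubset>\<^bsub>Q\<^esub> z"
      using le_trans[of x y z] le_antisym[of x y] by (auto simp: lless_def eq_is_equal)
  qed
  ultimately have "\<exists>m\<in>A. \<forall>x\<in>A. x \<noteq> m \<longrightarrow> \<not> m \<sqsubset>\<^bsub>Q\<^esub> x"
    using Finite_Set.bex_max_element assms(2,3) by blast
  then show ?thesis
    by (auto simp: mem_maximal_elements_restrict lless_def eq_is_equal)
qed

lemma lower_covers_ideal_lattice:
  assumes "partial_order Q" and I: "I \<in> carrier (ideal_lattice Q)"
  shows "lower_covers (ideal_lattice Q) I =
    (\<lambda>m. I - {m}) ` maximal_elements (Q\<lparr>carrier := I\<rparr>)" (is "?L = ?R")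
proof
  interpret partial_order Q by fact
  show "?L \<subseteq> ?R"
  proof
    fix J
    assume "J \<in> ?L"
    then have J: "J \<in> carrier (ideal_lattice Q)" "J \<subset> I"
      and cov: "\<And>K. K \<in> carrier (ideal_lattice Q) \<Longrightarrow> J \<subset> K \<Longrightarrow> \<not> K \<subset> I"
      by (auto simp: lower_covers_def)
    \<comment> \<open>A maximal element \<open>m\<close> of \<open>I - J\<close> is maximal in
      \<open>I\<close>: anything above it in \<open>I\<close> would lie in the ideal
      \<open>J\<close> and pull \<open>m\<close> into \<open>J\<close>. So \<open>I - {m}\<close> is
      an ideal containing \<open>J\<close>, and the covering relation forces equality.\<close>
    obtain m where m: "m \<in> maximal_elements (Q\<lparr>carrier := I - J\<rparr>)"
      using exists_maximal_element[OF assms(1), of "I - J"] I J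
      by (auto simp: ideal_lattice_carrier_iff)
    have "m \<in> maximal_elements (Q\<lparr>carrier := I\<rparr>)"
    proof -
      have "\<not> m \<sqsubset>\<^bsub>Q\<^esub> y" if "y \<in> I" for y
      proof
        assume less: "m \<sqsubset>\<^bsub>Q\<^esub> y"
        with m that have "y \<in> J"
          by (auto simp: mem_maximal_elements_restrict)
        moreover have "m \<sqsubseteq>\<^bsub>Q\<^esub> y" "m \<in> carrier Q"
          using less m I by (auto simp: mem_maximal_elements_restrict ideal_lattice_carrier_iff lless_def)
        ultimately have "m \<in> J"
          using J(1) unfolding ideal_lattice_carrier_iff by blast
        with m show False
          by (simp add: mem_maximal_elements_restrict)
      qed
      with m show ?thesis
        by (auto simp: mem_maximal_elements_restrict)
    qed
    moreover from this have "J = I - {m}"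
      using cov[of "I - {m}"] ideal_diff_maximal[OF assms, of "{m}"] m J(2)
      by (auto simp: mem_maximal_elements_restrict)
    ultimately show "J \<in> ?R"
      by blast
  qed
  show "?R \<subseteq> ?L"
    using ideal_diff_maximal[OF assms]
    by (auto simp: lower_covers_def mem_maximal_elements_restrict)
qed

text \<open>A set of lower covers is the family of all \<open>I - {m}\<close> with \<open>m\<close>
  in some set \<open>S\<close> of maximal elements. Its meet with \<open>I\<close> is
  \<open>I - S\<close>, which is itself an ideal.\<close>

lemma nontrivial_ungar_move_ideal_lattice:
  assumes "partial_order Q" and I: "I \<in> carrier (ideal_lattice Q)"
  shows "nontrivial_ungar_move (ideal_lattice Q) I J \<longleftrightarrow> removal_move Q I J"
proof -
  let ?M = "maximal_elements (Q\<lparr>carrier := I\<rparr>)"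
  have inf: "\<Sqinter>\<^bsub>ideal_lattice Q\<^esub>({I} \<union> (\<lambda>m. I - {m}) ` S) = I - S" if S: "S \<subseteq> ?M" for S
  proof -
    have "I - {m} \<in> carrier (ideal_lattice Q)" if "m \<in> S" for m
      using S that by (intro ideal_diff_maximal[OF assms]) auto
    then have "greatest (ideal_lattice Q) (I - S)
        (Lower (ideal_lattice Q) ({I} \<union> (\<lambda>m. I - {m}) ` S))"
      using ideal_diff_maximal[OF assms S] I
      by (auto simp: greatest_def Lower_def)
    then show ?thesis
      unfolding inf_def by (rule some_equality) (rule greatest_ideal_lattice_unique[OF _ \<open>greatest _ _ _\<close>])
  qed
  have "nontrivial_ungar_move (ideal_lattice Q) I J \<longleftrightarrow> (\<exists>S \<subseteq> ?M.
      (\<lambda>m. I - {m}) ` S \<noteq> {} \<and> J = \<Sqinter>\<^bsub>ideal_lattice Q\<^esub>({I} \<union> (\<lambda>m. I - {m}) ` S))"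
    unfolding nontrivial_ungar_move_def lower_covers_ideal_lattice[OF assms] subset_image_iff
    by blast
  also have "\<dots> \<longleftrightarrow> removal_move Q I J"
    unfolding removal_move_def using inf by (simp del: Un_insert_left) blast
  finally show ?thesis .
qed

lemma atniss_win_ideal_lattice_iff:
  assumes "partial_order Q" and fin: "finite (carrier Q)"
  shows "atniss_win (ideal_lattice Q) \<longleftrightarrow> mover_wins (removal_move Q) (carrier Q)"
proof -
  let ?L = "ideal_lattice Q"
  note move = nontrivial_ungar_move_ideal_lattice[OF assms(1)]
  have closed: "J \<in> carrier ?L" if "I \<in> carrier ?L" "removal_move Q I J" for I J
    using that ideal_diff_maximal[OF assms(1)] by (auto simp: removal_move_def)
  have top: "carrier Q \<in> carrier ?L"
    using fin by (auto simp: ideal_lattice_carrier_iff)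
  \<comment> \<open>Termination is inherited from removals, because both relations agree at ideals
    and moves stay among ideals.\<close>
  have "termip (nontrivial_ungar_move ?L) I" if "I \<in> carrier ?L" for I
  proof -
    have "finite I"
      using that by (simp add: ideal_lattice_carrier_iff)
    from termip_removal_move[OF this, of Q] that show ?thesis
    proof (induction rule: accp_induct_rule)
      case (1 I)
      show ?case
        by (rule accp.accI) (use 1 move closed in auto)
    qed
  qed
  then have "atniss_win ?L \<longleftrightarrow> mover_wins (nontrivial_ungar_move ?L) (carrier Q)"
    using atniss_win_if_mover_wins[of ?L] mover_wins_if_atniss_win[of ?L] top
    by (auto simp: ideal_lattice_top[OF fin])
  also have "\<dots> \<longleftrightarrow> mover_wins (removal_move Q) (carrier Q)"
    using top move closed by (intro mover_wins_cong_on[of _ "carrier ?L"]) auto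
  finally show ?thesis .
qed

text \<open>Lets the games on \<open>\<Lambda>\<close> and \<open>\<Lambda> - \<mu>\<close> be
  compared as one game with two starting sets.\<close>

lemma removal_move_restrict [simp]: "removal_move (P\<lparr>carrier := A\<rparr>) = removal_move P"
  by (intro ext) (simp add: removal_move_def)

lemma partial_order_restrict:
  assumes "partial_order P" and "A \<subseteq> carrier P"
  shows "partial_order (P\<lparr>carrier := A\<rparr>)"
proof -
  interpret partial_order P by fact
  show ?thesis
    using assms(2) by unfold_locales (auto simp: eq_is_equal intro: le_antisym le_trans)
qed

section \<open>Comparing the games with and without \<mu>\<close>

text \<open>An element that became maximal on deleting \<open>m\<close> would be a non-maximal
  element of \<delta>, hence below a second maximal element of \<delta>, which is still in
  \<open>K\<close>. \<open>K\<close> is not assumed to be an ideal, so the lemma applies to both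
  \<open>I\<close> and \<open>I - \<mu>\<close>.\<close>

lemma mover_wins_if_maximal_in_doubly_covered_ideal:
  assumes \<delta>: "\<delta> \<in> carrier (ideal_lattice P)"
    and two: "\<forall>x \<in> \<delta> - maximal_elements (P\<lparr>carrier := \<delta>\<rparr>).
           card {m \<in> maximal_elements (P\<lparr>carrier := \<delta>\<rparr>). x \<sqsubset>\<^bsub>P\<^esub> m} \<ge> 2"
    and K: "finite K" "K \<subseteq> carrier P" "maximal_elements (P\<lparr>carrier := \<delta>\<rparr>) \<subseteq> K"
    and m: "m \<in> maximal_elements (P\<lparr>carrier := K\<rparr>)" "m \<in> maximal_elements (P\<lparr>carrier := \<delta>\<rparr>)"
  shows "mover_wins (removal_move P) K"
proof (rule mover_wins_if_redundant_maximal[OF K(1) m(1)], rule subsetI, rule ccontr)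
  let ?M = "maximal_elements (P\<lparr>carrier := \<delta>\<rparr>)"
  fix x
  assume x: "x \<in> maximal_elements (P\<lparr>carrier := K - {m}\<rparr>)"
    "x \<notin> maximal_elements (P\<lparr>carrier := K\<rparr>)"
  then have xm: "x \<sqsubset>\<^bsub>P\<^esub> m" and xK: "x \<in> K"
    by (auto simp: mem_maximal_elements_restrict)
  have "m \<in> \<delta>"
    using m(2) by (simp add: mem_maximal_elements_restrict)
  with xm xK K(2) \<delta> have "x \<in> \<delta> - ?M"
    by (auto simp: mem_maximal_elements_restrict ideal_lattice_carrier_iff lless_def)
  with two have "\<not> card {m' \<in> ?M. x \<sqsubset>\<^bsub>P\<^esub> m'} \<le> card {m}"
    by (metis Suc_1 card_1_singleton_iff not_less_eq_eq One_nat_def)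
  then have "\<not> {m' \<in> ?M. x \<sqsubset>\<^bsub>P\<^esub> m'} \<subseteq> {m}"
    by (meson card_mono finite.emptyI finite.insertI)
  then obtain m' where "m' \<in> ?M" "x \<sqsubset>\<^bsub>P\<^esub> m'" "m' \<noteq> m"
    by blast
  with x(1) K(3) show False
    unfolding mem_maximal_elements_restrict[of x] by blast
qed

theorem theorem1p7:
  fixes P :: "('a, 'b) gorder_scheme" (structure)
    and \<delta> \<Lambda> :: "'a set"
  assumes "partial_order P"
    and "\<forall>x\<in>carrier P. finite {y \<in> carrier P. y \<sqsubseteq> x}"
    and "\<delta> \<in> carrier (ideal_lattice P)"
    and "\<Lambda> \<in> carrier (ideal_lattice P)"
    and "\<delta> \<subseteq> \<Lambda>"
    and "\<forall>x \<in> \<delta> - maximal_elements (P\<lparr>carrier := \<delta>\<rparr>).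
           card {m \<in> maximal_elements (P\<lparr>carrier := \<delta>\<rparr>). x \<sqsubset> m} \<ge> 2"
  shows "\<forall>\<mu> \<in> carrier (ideal_lattice P).
           \<mu> \<subseteq> \<delta> - maximal_elements (P\<lparr>carrier := \<delta>\<rparr>) \<longrightarrow>
             (atniss_win (ideal_lattice (P\<lparr>carrier := \<Lambda> - \<mu>\<rparr>)) \<longleftrightarrow>
              atniss_win (ideal_lattice (P\<lparr>carrier := \<Lambda>\<rparr>)))"
proof (intro ballI impI)
  fix \<mu>
  let ?max = "\<lambda>I. maximal_elements (P\<lparr>carrier := I\<rparr>)"
  let ?wins = "mover_wins (removal_move P)"
  assume \<mu>: "\<mu> \<in> carrier (ideal_lattice P)" "\<mu> \<subseteq> \<delta> - ?max \<delta>"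
  have \<Lambda>: "finite \<Lambda>" "\<Lambda> \<subseteq> carrier P"
    using assms(4) by (auto simp: ideal_lattice_carrier_iff)
  \<comment> \<open>The claim is generalised from \<Lambda> to every finite \<open>I\<close> between
    \<delta> and the carrier, so that it survives moves that spare \<delta>.\<close>
  have "?wins I \<longleftrightarrow> ?wins (I - \<mu>)" if "finite I" "\<delta> \<subseteq> I" "I \<subseteq> carrier P" for I
    using that
  proof (induction rule: finite_psubset_induct)
    case (psubset I)
    \<comment> \<open>An element below a member of the ideal \<mu> is itself in \<mu>, so removing
      \<mu> creates no maximal elements. None is lost, as a maximal element of \<open>I\<close>
      lying in \<delta> is maximal in \<delta> and so outside \<mu>.\<close>
    have max_eq: "?max (I - \<mu>) = ?max I"
    proof (intro equalityI subsetI)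
      fix x
      assume x: "x \<in> ?max (I - \<mu>)"
      then have "\<not> x \<sqsubset> y" if "y \<in> \<mu>" for y
        using that \<mu>(1) psubset.prems
        by (auto simp: mem_maximal_elements_restrict ideal_lattice_carrier_iff lless_def)
      with x show "x \<in> ?max I"
        by (auto simp: mem_maximal_elements_restrict)
    next
      fix x
      assume x: "x \<in> ?max I"
      then have "x \<in> \<delta> \<Longrightarrow> x \<in> ?max \<delta>"
        using psubset.prems by (auto simp: mem_maximal_elements_restrict)
      with \<mu>(2) have "x \<notin> \<mu>"
        by blast
      with x show "x \<in> ?max (I - \<mu>)"
        by (simp add: mem_maximal_elements_restrict)
    qed
    have sub: "?max \<delta> \<subseteq> I" "?max \<delta> \<subseteq> I - \<mu>"
      using psubset.prems \<mu>(2) by (auto simp: mem_maximal_elements_restrict)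
    show ?case
    proof (cases "?max I \<inter> ?max \<delta> = {}")
      case True
      have "?wins (I - S) \<longleftrightarrow> ?wins (I - \<mu> - S)" if "S \<subseteq> ?max I" "S \<noteq> {}" for S
      proof -
        \<comment> \<open>An element of \<open>S\<close> in \<delta> would be maximal in \<delta>
          too, which the case assumption excludes.\<close>
        have "\<delta> \<subseteq> I - S"
          using True that psubset.prems by (fastforce simp: mem_maximal_elements_restrict)
        moreover have "I - S \<subset> I"
          using that removal_move_psubset[of P I "I - S"] by (auto simp: removal_move_def)
        moreover have "I - S - \<mu> = I - \<mu> - S"
          by blast
        ultimately show ?thesis
          using psubset.IH[of "I - S"] psubset.prems by auto
      qed
      then show ?thesis
        using psubset.hyps
        by (simp add: mover_wins_removal_move_iff[of I] mover_wins_removal_move_iff[of "I - \<mu>"]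
            max_eq) blast
    next
      case False
      then obtain m where "m \<in> ?max I" "m \<in> ?max \<delta>"
        by blast
      then have "?wins I" "?wins (I - \<mu>)"
        using psubset.hyps psubset.prems sub max_eq
        by (auto intro!: mover_wins_if_maximal_in_doubly_covered_ideal[OF assms(3,6)])
      then show ?thesis
        by simp
    qed
  qed
  moreover have "atniss_win (ideal_lattice (P\<lparr>carrier := A\<rparr>)) \<longleftrightarrow> ?wins A" if "A \<subseteq> \<Lambda>" for A
    using atniss_win_ideal_lattice_iff[OF partial_order_restrict[OF assms(1), of A]] that \<Lambda>
    by (auto simp: finite_subset)
  ultimately show "atniss_win (ideal_lattice (P\<lparr>carrier := \<Lambda> - \<mu>\<rparr>)) \<longleftrightarrow>
      atniss_win (ideal_lattice (P\<lparr>carrier := \<Lambda>\<rparr>))"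
    using assms(5) \<Lambda> by auto
qed

end
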